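(* For every integer $n \geq 166$ there exists a geometric $(n_5)$ configuration. Equivalently, $N_5 \le 166$, where $N_5$ denotes the smallest integer such that a geometric $(n_5)$ configuration exists for every $n \ge N_5$.
   Context: A geometric $(n_k)$ configuration is a collection of $n$ points and $n$ straight lines in the Euclidean plane such that each of the lines passes through exactly $k$ of the points and each of the points lies on exactly $k$ of the lines. For each $k$, $N_k$ denotes the least integer such that for all $n \ge N_k$ there exists at least one geometric $(n_k)$ configuration. *)

theory Defs
  imports "HOL-Analysis.Analysis"
begin

definition straight_line :: "(real^2) set \<Rightarrow> bool" where
  "straight_line l \<longleftrightarrow> affine l \<and> aff_dim l = 1"

definition geometric_configuration ::
    "nat \<Rightarrow> nat \<Rightarrow> (real^2) set \<Rightarrow> (real^2) set set \<Rightarrow> bool" where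
  "geometric_configuration n k P L \<longleftrightarrow>
     finite P \<and> card P = n \<and>
     finite L \<and> card L = n \<and> (\<forall>l\<in>L. straight_line l) \<and>
     (\<forall>l\<in>L. card {p \<in> P. p \<in> l} = k) \<and>
     (\<forall>p\<in>P. card {l \<in> L. p \<in> l} = k)"

definition exists_geometric_configuration :: "nat \<Rightarrow> nat \<Rightarrow> bool" where
  "exists_geometric_configuration n k \<longleftrightarrow> (\<exists>P L. geometric_configuration n k P L)"

(* LEAST is meaningful only if some threshold exists for k. *)
definition config_threshold :: "nat \<Rightarrow> nat" where
  "config_threshold k = (LEAST m. \<forall>n\<ge>m. exists_geometric_configuration n k)"

end

(* Idea. Configurations can be added: after a generic translation, the union of an (m_k) and an (n_k)
   configuration is an ((m + n)_k) configuration. So it suffices to find one (66_5) configuration and,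
   for every residue class modulo 66, one (n_5) configuration with n <= 231.

   Most of these come from a variant of affine replication. Take a set of points and lines in which every
   point lies on 4 or 5 of the lines and every line contains 4 or 5 of the points. Under the maps
   (x, y) -> (x, t^i y), i = 0, ..., 4, the five images of a line meet on the axis y = 0, and the five images
   of a point lie on a vertical line. Adding the axis point of every 4-point line and the vertical line
   through every point of degree 4 yields an (n_5) configuration, where n is five times the number of points
   plus the number of 4-point lines. Suitable seeds with 21 to 38 points exist among the points and lines of
   the rational projective plane with small integer coordinates. *)
theory Submission
  imports Defs
begin

section \<open>Configurations in coordinates\<close>

definition slope_line :: "real \<times> real \<Rightarrow> (real^2) set" where
  "slope_line l = {v. v $ 2 = fst l * v $ 1 + snd l}"

definition vertical_line :: "real \<Rightarrow> (real^2) set" where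
  "vertical_line c = {v. v $ 1 = c}"

definition pt :: "real \<times> real \<Rightarrow> real^2" where
  "pt p = vector [fst p, snd p]"

lemma pt_nth [simp]: "pt p $ 1 = fst p" "pt p $ 2 = snd p"
  by (simp_all add: pt_def)

lemma inj_pt: "inj pt"
  by (metis injI pt_nth prod.expand)

text \<open>A hyperplane of the plane has dimension 2 - 1 = 1, so exhibiting a nonzero normal vector
  settles both conditions of \<open>straight_line\<close>.\<close>

lemma straight_line_hyperplane:
  fixes a :: "real^2"
  assumes "a \<noteq> 0"
  shows "straight_line {v. a \<bullet> v = r}"
  using aff_dim_hyperplane[OF assms, of r] affine_hyperplane[of a r]
  by (simp add: straight_line_def)

lemma straight_line_slope_line: "straight_line (slope_line l)"
proof -
  have "slope_line l = {v. vector [- fst l, 1] \<bullet> v = snd l}"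
    by (auto simp: slope_line_def inner_vec_def sum_2)
  moreover have "vector [- fst l, 1] \<noteq> (0 :: real^2)"
    by (metis vector_2(2) zero_index zero_neq_one)
  ultimately show ?thesis
    using straight_line_hyperplane by metis
qed

lemma straight_line_vertical_line: "straight_line (vertical_line c)"
proof -
  have "vertical_line c = {v. vector [1, 0] \<bullet> v = c}"
    by (auto simp: vertical_line_def inner_vec_def sum_2)
  moreover have "vector [1, 0] \<noteq> (0 :: real^2)"
    by (metis vector_2(1) zero_index zero_neq_one)
  ultimately show ?thesis
    using straight_line_hyperplane by metis
qed

lemma inj_slope_line: "inj slope_line"
proof (rule injI)
  fix l l' assume eq: "slope_line l = slope_line l'"
  have "pt (0, snd l) \<in> slope_line l" "pt (1, fst l + snd l) \<in> slope_line l"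
    by (auto simp: slope_line_def)
  then show "l = l'"
    unfolding eq by (auto simp: slope_line_def prod_eq_iff)
qed

lemma inj_vertical_line: "inj vertical_line"
proof (rule injI)
  fix c c' assume eq: "vertical_line c = vertical_line c'"
  have "pt (c, 0) \<in> vertical_line c"
    by (auto simp: vertical_line_def)
  then show "c = c'"
    unfolding eq by (auto simp: vertical_line_def)
qed

lemma slope_line_neq_vertical_line: "slope_line l \<noteq> vertical_line c"
proof
  assume eq: "slope_line l = vertical_line c"
  have "pt (c + 1, fst l * (c + 1) + snd l) \<in> slope_line l"
    by (auto simp: slope_line_def)
  then show False
    unfolding eq by (auto simp: vertical_line_def)
qed

definition on_line :: "real \<times> real \<Rightarrow> real \<times> real \<Rightarrow> bool" where
  "on_line p l \<longleftrightarrow> snd p = fst l * fst p + snd l"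

text \<open>Points become pairs and lines become slope-intercept pairs or abscissae. These encodings
  are injective and the two kinds of line never coincide, so all incidence counts carry over. A
  point lies on at most one vertical line, whence the summand 0 or 1 in the last hypothesis.\<close>

lemma exists_configuration_from_coordinates:
  fixes P M :: "(real \<times> real) set" and V :: "real set"
  assumes fin: "finite P" "finite M" "finite V"
    and card: "card P = n" "card M + card V = n"
    and M: "\<And>l. l \<in> M \<Longrightarrow> card {p \<in> P. on_line p l} = k"
    and V: "\<And>c. c \<in> V \<Longrightarrow> card {p \<in> P. fst p = c} = k"
    and P: "\<And>p. p \<in> P \<Longrightarrow> card {l \<in> M. on_line p l} + (if fst p \<in> V then 1 else 0) = k"
  shows "exists_geometric_configuration n k"
proof -
  let ?P = "pt ` P" and ?L = "slope_line ` M \<union> vertical_line ` V"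
  have disj: "slope_line ` A \<inter> vertical_line ` B = {}" for A B
    using slope_line_neq_vertical_line by auto
  have cardP: "card (pt ` A) = card A" for A
    by (rule card_image) (meson inj_pt inj_on_subset subset_UNIV)
  have cardM: "card (slope_line ` A) = card A" for A
    by (rule card_image) (meson inj_slope_line inj_on_subset subset_UNIV)
  have cardV: "card (vertical_line ` A) = card A" for A
    by (rule card_image) (meson inj_vertical_line inj_on_subset subset_UNIV)
  have "card ?L = n"
    using fin card by (simp add: card_Un_disjoint disj cardM cardV)
  moreover have "card {q \<in> ?P. q \<in> l} = k" if "l \<in> ?L" for l
  proof -
    have "{q \<in> ?P. q \<in> slope_line l} = pt ` {p \<in> P. on_line p l}" for l
      by (auto simp: slope_line_def on_line_def)
    moreover have "{q \<in> ?P. q \<in> vertical_line c} = pt ` {p \<in> P. fst p = c}" for c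
      by (auto simp: vertical_line_def)
    ultimately show ?thesis
      using that M V by (auto simp: cardP)
  qed
  moreover have "card {l \<in> ?L. pt p \<in> l} = k" if "p \<in> P" for p
  proof -
    have "{l \<in> ?L. pt p \<in> l} = slope_line ` {l \<in> M. on_line p l} \<union> vertical_line ` ({fst p} \<inter> V)"
      by (auto simp: slope_line_def on_line_def vertical_line_def)
    then have "card {l \<in> ?L. pt p \<in> l} = card {l \<in> M. on_line p l} + card ({fst p} \<inter> V)"
      using fin by (simp add: card_Un_disjoint disj cardM cardV)
    then show ?thesis
      using P[OF that] by (auto split: if_splits)
  qed
  ultimately have "geometric_configuration n k ?P ?L"
    unfolding geometric_configuration_def
    using fin card straight_line_slope_line straight_line_vertical_line by (auto simp: cardP)
  then show ?thesis
    unfolding exists_geometric_configuration_def by blast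
qed

section \<open>Disjoint unions\<close>

lemma straight_line_translation:
  assumes "straight_line l"
  shows "straight_line ((+) v ` l)"
  using assms affine_translation[of l v] by (simp add: straight_line_def aff_dim_translation_eq)

text \<open>Needed because the translations v with p in v + l form the set p - l, a translate of the
  reflected line -l.\<close>

lemma straight_line_uminus:
  assumes "straight_line l"
  shows "straight_line (uminus ` l)"
proof -
  have "bounded_linear (uminus :: real^2 \<Rightarrow> real^2)"
    by (intro bounded_linear_minus bounded_linear_ident)
  from affine_hull_linear_image[OF this, of l] have "affine (uminus ` (affine hull l))"
    by (simp only: affine_affine_hull)
  then have "affine (uminus ` l)"
    using assms by (simp add: straight_line_def hull_same)
  then show ?thesis
    using assms aff_dim_injective_linear_image[OF linear_uminus, of l] by (simp add: straight_line_def)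
qed

text \<open>Dimension 1 < 2 forces an empty interior, and a convex set with empty interior has
  measure zero.\<close>

lemma straight_line_negligible:
  assumes "straight_line l"
  shows "negligible l"
proof -
  have "interior l = {}"
    using assms aff_dim_nonempty_interior[of l] by (force simp: straight_line_def)
  then show ?thesis
    using assms negligible_convex_interior[of l] affine_imp_convex by (auto simp: straight_line_def)
qed

lemma geometric_configuration_translation:
  assumes "geometric_configuration n k P L"
  shows "geometric_configuration n k ((+) v ` P) ((`) ((+) v) ` L)"
proof -
  have inj: "inj ((+) v)" "inj ((`) ((+) v))"
    by (simp_all add: inj_image_eq_iff inj_def)
  have card: "card ((+) v ` A) = card A" for A
    by (rule card_image) simp
  have card': "card ((`) ((+) v) ` A) = card A" for A
    by (rule card_image) (meson inj(2) inj_on_subset subset_UNIV)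
  have "{p \<in> (+) v ` P. p \<in> (+) v ` l} = (+) v ` {p \<in> P. p \<in> l}" for l
    by auto
  moreover have "{l \<in> (`) ((+) v) ` L. v + p \<in> l} = (`) ((+) v) ` {l \<in> L. p \<in> l}" for p
    by auto
  ultimately show ?thesis
    using assms straight_line_translation
    by (auto simp: geometric_configuration_def card card')
qed

text \<open>Each forbidden coincidence confines v to a line: v + q in l means v in l - q, and p in v
  + l means v in p - l. Finitely many such lines form a null set, so they do not exhaust the
  plane.\<close>

lemma exists_translation_avoiding:
  assumes "finite P" "finite Q" "finite K" "finite L"
    and "\<And>l. l \<in> K \<union> L \<Longrightarrow> straight_line l"
  shows "\<exists>v :: real^2. (\<forall>q\<in>Q. \<forall>l\<in>K. v + q \<notin> l) \<and>
    (\<forall>p\<in>P. \<forall>l\<in>L. p \<notin> (+) v ` l)"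
proof -
  let ?N = "(\<Union>q\<in>Q. \<Union>l\<in>K. (+) (- q) ` l) \<union>
    (\<Union>p\<in>P. \<Union>l\<in>L. (-) p ` l)"
  have "negligible ((+) (- q) ` l)" if "l \<in> K" for q l
    using that assms by (intro negligible_translation straight_line_negligible) auto
  moreover have "negligible ((-) p ` l)" if "l \<in> L" for p l
  proof -
    have "negligible ((+) p ` uminus ` l)"
      using that assms
      by (intro negligible_translation straight_line_negligible straight_line_uminus) auto
    then show ?thesis
      by (simp add: image_image)
  qed
  ultimately have "negligible ?N"
    using assms by (intro negligible_Un negligible_Union) auto
  then obtain v where v: "v \<notin> ?N"
    by (metis UNIV_eq_I non_negligible_UNIV)
  have "v + q \<notin> l" if "q \<in> Q" "l \<in> K" for q l
    using v that by (force simp: image_iff)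
  moreover have "p \<notin> (+) v ` l" if "p \<in> P" "l \<in> L" for p l
    using v that by (force simp: image_iff)
  ultimately show ?thesis
    by blast
qed

lemma exists_geometric_configuration_add:
  assumes "exists_geometric_configuration m k" "exists_geometric_configuration n k" "k > 0"
  shows "exists_geometric_configuration (m + n) k"
proof -
  obtain P K where PK: "geometric_configuration m k P K"
    using assms unfolding exists_geometric_configuration_def by blast
  obtain Q L where QL: "geometric_configuration n k Q L"
    using assms unfolding exists_geometric_configuration_def by blast
  have "finite P" "finite Q" "finite K" "finite L" "\<And>l. l \<in> K \<union> L \<Longrightarrow> straight_line l"
    using PK QL by (auto simp: geometric_configuration_def)
  then obtain v where v: "\<forall>q\<in>Q. \<forall>l\<in>K. v + q \<notin> l"
      "\<forall>p\<in>P. \<forall>l\<in>L. p \<notin> (+) v ` l"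
    using exists_translation_avoiding[of P Q K L] by blast
  define Q' L' where "Q' = (+) v ` Q" and "L' = (`) ((+) v) ` L"
  have QL': "geometric_configuration n k Q' L'"
    unfolding Q'_def L'_def by (rule geometric_configuration_translation[OF QL])
  have Q'K: "q \<notin> l" if "q \<in> Q'" "l \<in> K" for q l
    using that v(1) by (auto simp: Q'_def)
  have PL': "p \<notin> l" if "p \<in> P" "l \<in> L'" for p l
    using that v(2) by (auto simp: L'_def)
  have inhabited: "\<exists>l\<in>K. p \<in> l" if "p \<in> P" for p
  proof -
    have "card {l \<in> K. p \<in> l} \<noteq> 0"
      using PK that \<open>k > 0\<close> by (simp add: geometric_configuration_def)
    then show ?thesis
      by (metis (no_types, lifting) card_eq_0_iff empty_Collect_eq)
  qed
  have inhabited': "\<exists>q\<in>Q'. q \<in> l" if "l \<in> L'" for l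
  proof -
    have "card {q \<in> Q'. q \<in> l} \<noteq> 0"
      using QL' that \<open>k > 0\<close> by (simp add: geometric_configuration_def)
    then show ?thesis
      by (metis (no_types, lifting) card_eq_0_iff empty_Collect_eq)
  qed
  \<comment> \<open>This is where k > 0 enters. Each point of P lies on a line of K and each line of
    \<open>L'\<close> contains a point of \<open>Q'\<close>, while no point of \<open>Q'\<close>
    lies on a line of K.\<close>
  have "P \<inter> Q' = {}" "K \<inter> L' = {}"
    using inhabited inhabited' Q'K by blast+
  moreover have "{p \<in> P \<union> Q'. p \<in> l} = {p \<in> P. p \<in> l}" if "l \<in> K" for l
    using that Q'K by blast
  moreover have "{p \<in> P \<union> Q'. p \<in> l} = {p \<in> Q'. p \<in> l}" if "l \<in> L'" for l
    using that PL' by blast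
  moreover have "{l \<in> K \<union> L'. p \<in> l} = {l \<in> K. p \<in> l}" if "p \<in> P" for p
    using that PL' by blast
  moreover have "{l \<in> K \<union> L'. p \<in> l} = {l \<in> L'. p \<in> l}" if "p \<in> Q'" for p
    using that Q'K by blast
  ultimately have "geometric_configuration (m + n) k (P \<union> Q') (K \<union> L')"
    using PK QL' unfolding geometric_configuration_def by (auto simp: card_Un_disjoint)
  then show ?thesis
    unfolding exists_geometric_configuration_def by blast
qed

section \<open>Affine replication\<close>

text \<open>The x-intercept of a non-horizontal line. The corresponding axis point is fixed by all
  maps (x, y) -> (x, t^i y), hence common to all copies of the line.\<close>

definition axis_hit :: "real \<times> real \<Rightarrow> real" where
  "axis_hit l = - snd l / fst l"

lemma axis_hit_iff:
  assumes "fst l \<noteq> 0"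
  shows "fst l * x + snd l = 0 \<longleftrightarrow> x = axis_hit l"
  using assms by (auto simp: axis_hit_def field_simps)

text \<open>The equation says that the i-th copy of p lies on the j-th copy of l. Let s be the
  height of l at the abscissa of p. For i \<noteq> j the equation makes |snd p / s| or its inverse a
  positive power of t, which is impossible once t exceeds these finitely many numbers. For i = j the
  powers cancel.\<close>

lemma exists_dilation_separating:
  fixes P M :: "(real \<times> real) set"
  assumes "finite P" "finite M"
    and P: "\<And>p. p \<in> P \<Longrightarrow> snd p \<noteq> 0"
    and PM: "\<And>p l. p \<in> P \<Longrightarrow> l \<in> M \<Longrightarrow> fst l * fst p + snd l \<noteq> 0"
  obtains t :: real where "t > 1"
    and "\<And>i j p l. p \<in> P \<Longrightarrow> l \<in> M \<Longrightarrow>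
           t ^ i * snd p = t ^ j * (fst l * fst p + snd l) \<longleftrightarrow> i = j \<and> on_line p l"
proof -
  define r where "r p l = \<bar>snd p / (fst l * fst p + snd l)\<bar>" for p l :: "real \<times> real"
  define Q where "Q = (\<lambda>(p, l). r p l) ` (P \<times> M)"
  \<comment> \<open>The inserted 1 keeps the set nonempty and gives t > 1; the added 1 makes all the
    bounds strict.\<close>
  define t where "t = Max (insert 1 (Q \<union> inverse ` Q)) + 1"
  have fin: "finite (insert 1 (Q \<union> inverse ` Q))"
    using assms by (simp add: Q_def)
  have t1: "t > 1"
    using Max_ge[OF fin, of 1] by (simp add: t_def)
  have r: "r p l < t" "inverse (r p l) < t" if "p \<in> P" "l \<in> M" for p l
  proof -
    have "r p l \<in> Q"
      using that by (force simp: Q_def)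
    then show "r p l < t" "inverse (r p l) < t"
      using Max_ge[OF fin, of "r p l"] Max_ge[OF fin, of "inverse (r p l)"] by (auto simp: t_def)
  qed
  have pow: "t \<le> t ^ d" if "d > 0" for d
    using that t1 by (simp add: self_le_power)
  have exponent: "i = j"
    if pl: "p \<in> P" "l \<in> M" and eq: "t ^ i * snd p = t ^ j * (fst l * fst p + snd l)" for i j p l
  proof (rule ccontr)
    assume "i \<noteq> j"
    let ?s = "fst l * fst p + snd l"
    have nz: "snd p \<noteq> 0" "?s \<noteq> 0" "t \<noteq> 0"
      using P PM pl t1 by auto
    then have "snd p / ?s = t ^ j / t ^ i"
      using eq by (simp add: field_simps)
    then have rr: "r p l = t ^ j / t ^ i"
      using t1 by (simp add: r_def)
    consider "i < j" | "j < i"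
      using \<open>i \<noteq> j\<close> by linarith
    then show False
    proof cases
      case 1
      then have "r p l = t ^ (j - i)"
        using rr nz by (simp add: power_diff)
      then show False
        using r(1)[OF pl] pow[of "j - i"] 1 by simp
    next
      case 2
      then have "inverse (r p l) = t ^ (i - j)"
        using rr nz by (simp add: power_diff)
      then show False
        using r(2)[OF pl] pow[of "i - j"] 2 by simp
    qed
  qed
  have "t ^ i * snd p = t ^ j * (fst l * fst p + snd l) \<longleftrightarrow> i = j \<and> on_line p l"
    if pl: "p \<in> P" "l \<in> M" for i j p l
  proof -
    have "t \<noteq> 0"
      using t1 by simp
    then show ?thesis
      using exponent[OF pl, of i j] by (auto simp: on_line_def)
  qed
  with t1 show thesis
    using that by blast
qed

text \<open>A collects the points that still need a line and B the lines that still need a point.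
  Distinct abscissae keep the vertical lines apart, distinct x-intercepts keep the axis points
  apart, and the last condition keeps axis points off the vertical lines. Since no point is on the
  axis, its copies are distinct and differ from the axis points. The two equations count the
  resulting points and lines.\<close>

lemma affine_replication:
  fixes P M :: "(real \<times> real) set" and k n :: nat
  defines "A \<equiv> {p \<in> P. Suc (card {l \<in> M. on_line p l}) = k}"
    and "B \<equiv> {l \<in> M. Suc (card {p \<in> P. on_line p l}) = k}"
  assumes fin: "finite P" "finite M"
    and P: "\<And>p. p \<in> P \<Longrightarrow> card {l \<in> M. on_line p l} \<in> {k - 1, k}"
    and M: "\<And>l. l \<in> M \<Longrightarrow> card {p \<in> P. on_line p l} \<in> {k - 1, k}"
    and "k > 0"
    and n: "k * card P + card B = n" "k * card M + card A = n"
    and inj: "inj_on fst P" "inj_on axis_hit M"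
    and nz: "\<And>p. p \<in> P \<Longrightarrow> snd p \<noteq> 0" "\<And>l. l \<in> M \<Longrightarrow> fst l \<noteq> 0"
      "\<And>p l. p \<in> P \<Longrightarrow> l \<in> M \<Longrightarrow> fst l * fst p + snd l \<noteq> 0"
  shows "exists_geometric_configuration n k"
proof -
  obtain t :: real where t: "t > 1"
    and on: "\<And>i j p l. p \<in> P \<Longrightarrow> l \<in> M \<Longrightarrow>
      t ^ i * snd p = t ^ j * (fst l * fst p + snd l) \<longleftrightarrow> i = j \<and> on_line p l"
    using exists_dilation_separating[OF fin nz(1,3)] by blast
  \<comment> \<open>The i-th map multiplies ordinates by t^i, so it multiplies both the slope and
    the intercept of a line by t^i.\<close>
  define sp where "sp = (\<lambda>(i, p :: real \<times> real). (fst p, t ^ i * snd p))"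
  define sl where "sl = (\<lambda>(i, l :: real \<times> real). (t ^ i * fst l, t ^ i * snd l))"
  define hit where "hit l = (axis_hit l, 0 :: real)" for l
  define P' where "P' = sp ` ({..<k} \<times> P) \<union> hit ` B"
  define M' where "M' = sl ` ({..<k} \<times> M)"
  define V where "V = fst ` A"
  have sub: "A \<subseteq> P" "B \<subseteq> M"
    by (auto simp: A_def B_def)
  then have finAB: "finite A" "finite B"
    using fin finite_subset by blast+
  have inj_sp: "inj_on sp ({..<k} \<times> P)"
  proof (rule inj_onI)
    fix a b assume ab: "a \<in> {..<k} \<times> P" "b \<in> {..<k} \<times> P" "sp a = sp b"
    then have "snd a = snd b" "snd (snd a) \<noteq> 0"
      using inj(1) nz(1) by (auto simp: sp_def inj_on_def split: prod.splits)
    moreover from this have "t ^ fst a = t ^ fst b"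
      using ab(3) by (auto simp: sp_def split: prod.splits)
    then have "fst a = fst b"
      using t by simp
    ultimately show "a = b"
      by (simp add: prod_eq_iff)
  qed
  have hit_eq: "axis_hit l = axis_hit l' \<longleftrightarrow> l = l'" if "l \<in> M" "l' \<in> M" for l l'
    using inj(2) that by (auto simp: inj_on_def)
  have inj_sl: "inj_on sl ({..<k} \<times> M)"
  proof (rule inj_onI, clarsimp simp: sl_def)
    fix i j a b c d
    assume *: "(a, b) \<in> M" "(c, d) \<in> M" "t ^ i * a = t ^ j * c" "t ^ i * b = t ^ j * d"
    \<comment> \<open>The factor t^i cancels in the x-intercept, so equal copies come from the same
      line; its nonzero slope then yields i = j.\<close>
    have "axis_hit (a, b) = - (t ^ i * b) / (t ^ i * a)"
      using t by (simp add: axis_hit_def)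
    also have "\<dots> = axis_hit (c, d)"
      using t * by (simp add: axis_hit_def)
    finally have "(a, b) = (c, d)"
      using hit_eq * by blast
    moreover from this have "t ^ i = t ^ j"
      using * nz(2)[of "(a, b)"] by auto
    then have "i = j"
      using t by simp
    ultimately show "i = j \<and> a = c \<and> b = d"
      by simp
  qed
  have inj_hit: "inj_on hit B"
    using inj_on_subset[OF inj(2) sub(2)] by (simp add: inj_on_def hit_def)
  have disj: "sp ` ({..<k} \<times> P) \<inter> hit ` B = {}"
    using nz(1) t by (force simp: sp_def hit_def)
  have on_hit: "on_line (hit l) (sl (i, l')) \<longleftrightarrow> l = l'" if "l \<in> M" "l' \<in> M" for l l' i
  proof -
    have "on_line (hit l) (sl (i, l')) \<longleftrightarrow> t ^ i * (fst l' * axis_hit l + snd l') = 0"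
      by (auto simp: on_line_def hit_def sl_def distrib_left mult.assoc)
    also have "\<dots> \<longleftrightarrow> fst l' * axis_hit l + snd l' = 0"
      using t by simp
    also have "\<dots> \<longleftrightarrow> axis_hit l = axis_hit l'"
      by (rule axis_hit_iff[OF nz(2)[OF that(2)]])
    finally show ?thesis
      using hit_eq that by blast
  qed
  have on_sp: "on_line (sp (i, p)) (sl (j, l)) \<longleftrightarrow> i = j \<and> on_line p l"
    if "p \<in> P" "l \<in> M" for i j p l
    using on[OF that, of i j] by (simp add: on_line_def sp_def sl_def algebra_simps)
  have hit_ne: "fst p \<noteq> axis_hit l" if "p \<in> P" "l \<in> M" for p l
    using nz(3)[OF that] axis_hit_iff[OF nz(2)[OF that(2)], of "fst p"] by blast
  show ?thesis
  proof (rule exists_configuration_from_coordinates)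
    show "finite P'" "finite M'" "finite V"
      using fin finAB by (simp_all add: P'_def M'_def V_def)
    show "card P' = n"
      unfolding P'_def using fin finAB disj n
      by (simp add: card_Un_disjoint card_image inj_sp inj_hit card_cartesian_product)
    have "card V = card A"
      unfolding V_def using inj_on_subset[OF inj(1) sub(1)] by (rule card_image)
    then show "card M' + card V = n"
      unfolding M'_def using n by (simp add: card_image inj_sl card_cartesian_product)
  next
    fix m assume "m \<in> M'"
    then obtain i l where il: "m = sl (i, l)" "i < k" "l \<in> M"
      by (auto simp: M'_def)
    have "inj_on (\<lambda>p. sp (i, p)) {p \<in> P. on_line p l}"
      using inj_sp il by (auto simp: inj_on_def)
    then have card: "card ((\<lambda>p. sp (i, p)) ` {p \<in> P. on_line p l}) = card {p \<in> P. on_line p l}"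
      by (rule card_image)
    have on_m: "on_line (sp (j, p)) m \<longleftrightarrow> j = i \<and> on_line p l" if "p \<in> P" for j p
      using on_sp il that by simp
    have hit_m: "on_line (hit l') m \<longleftrightarrow> l' = l" if "l' \<in> B" for l'
      using on_hit il that sub by blast
    \<comment> \<open>The i-th copy of l meets only i-th copies of points of l, together with the
      axis point of l if l is in B, so the count is k in both cases.\<close>
    have "{q \<in> P'. on_line q m} =
        (\<lambda>p. sp (i, p)) ` {p \<in> P. on_line p l} \<union> hit ` ({l} \<inter> B)"
      using il(2) on_m hit_m by (auto simp: P'_def)
    moreover have "(\<lambda>p. sp (i, p)) ` {p \<in> P. on_line p l} \<inter> hit ` ({l} \<inter> B) = {}"
      using disj il by blast
    ultimately have "card {q \<in> P'. on_line q m} =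
        card {p \<in> P. on_line p l} + card (hit ` ({l} \<inter> B))"
      using fin finAB by (simp add: card_Un_disjoint card)
    also have "\<dots> = k"
      using M[OF \<open>l \<in> M\<close>] \<open>k > 0\<close> \<open>l \<in> M\<close> by (cases "l \<in> B") (auto simp: B_def)
    finally show "card {q \<in> P'. on_line q m} = k" .
  next
    fix c assume "c \<in> V"
    then obtain p where p: "c = fst p" "p \<in> A"
      by (auto simp: V_def)
    then have "p \<in> P"
      using sub by blast
    have "fst (sp (i, r)) = fst p \<longleftrightarrow> r = p" if "r \<in> P" for i r
      using inj_on_eq_iff[OF inj(1) that \<open>p \<in> P\<close>] by (simp add: sp_def)
    moreover have "fst (hit l) \<noteq> fst p" if "l \<in> B" for l
      using hit_ne[OF \<open>p \<in> P\<close>, of l] that sub by (auto simp: hit_def)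
    \<comment> \<open>The vertical line through p carries exactly the k copies of p: other points
      have other abscissae, and no axis point lies below p.\<close>
    ultimately have "{q \<in> P'. fst q = fst p} = sp ` ({..<k} \<times> {p})"
      using \<open>p \<in> P\<close> by (auto simp: P'_def)
    moreover have "inj_on sp ({..<k} \<times> {p})"
      using inj_sp by (rule inj_on_subset) (use p sub in auto)
    ultimately show "card {q \<in> P'. fst q = c} = k"
      unfolding p(1) by (simp add: card_image card_cartesian_product)
  next
    fix q assume "q \<in> P'"
    then consider i p where "q = sp (i, p)" "i < k" "p \<in> P" | l where "q = hit l" "l \<in> B"
      by (auto simp: P'_def)
    then show "card {m \<in> M'. on_line q m} + (if fst q \<in> V then 1 else 0) = k"
    proof cases
      case 1
      have "inj_on (\<lambda>l. sl (i, l)) {l \<in> M. on_line p l}"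
        using inj_sl 1 by (auto simp: inj_on_def)
      then have "card ((\<lambda>l. sl (i, l)) ` {l \<in> M. on_line p l}) = card {l \<in> M. on_line p l}"
        by (rule card_image)
      moreover have "on_line q (sl (j, l)) \<longleftrightarrow> j = i \<and> on_line p l" if "l \<in> M" for j l
        using on_sp 1 that by auto
      then have "{m \<in> M'. on_line q m} = (\<lambda>l. sl (i, l)) ` {l \<in> M. on_line p l}"
        using 1(2) by (auto simp: M'_def)
      \<comment> \<open>Replication preserves abscissae, and these are distinct on P, so a copy of p
        is on an added vertical line only if that line was added for p.\<close>
      moreover have "fst q \<in> V \<longleftrightarrow> p \<in> A"
        using inj_on_image_mem_iff[OF inj(1) \<open>p \<in> P\<close> sub(1)] 1(1) by (simp add: V_def sp_def)
      ultimately show ?thesis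
        using P[OF \<open>p \<in> P\<close>] \<open>k > 0\<close> \<open>p \<in> P\<close> by (cases "p \<in> A") (auto simp: A_def)
    next
      case 2
      have "l \<in> M"
        using 2 sub by blast
      then have "on_line q (sl (j, l')) \<longleftrightarrow> l' = l" if "l' \<in> M" for j l'
        using on_hit 2 that by auto
      \<comment> \<open>An axis point lies on the k copies of its own line and on nothing
        else.\<close>
      then have "{m \<in> M'. on_line q m} = sl ` ({..<k} \<times> {l})"
        using \<open>l \<in> M\<close> by (auto simp: M'_def)
      moreover have "inj_on sl ({..<k} \<times> {l})"
        using inj_sl by (rule inj_on_subset) (use 2 sub in auto)
      moreover have "fst q \<noteq> fst p" if "p \<in> A" for p
        using hit_ne[of p l] that sub \<open>l \<in> M\<close> 2(1) by (auto simp: hit_def)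
      then have "fst q \<notin> V"
        by (auto simp: V_def)
      ultimately show ?thesis
        by (simp add: card_image card_cartesian_product)
    qed
  qed
qed

section \<open>Configurations given by integer homogeneous coordinates\<close>

type_synonym int_triple = "int \<times> int \<times> int"

fun dot :: "int_triple \<Rightarrow> int_triple \<Rightarrow> int" where
  "dot (a, b, c) (x, y, z) = a * x + b * y + c * z"

text \<open>A fixed projective coordinate change, chosen such that all the sets used below are in general
  position with respect to the new axis and the new vertical direction. The matrix acting on lines is
  the cofactor matrix of the one acting on points; 12572 is the determinant of the latter.\<close>

definition proj_point :: "int_triple \<Rightarrow> int_triple" where
  "proj_point v = (dot (-26, -13, -8) v, dot (1, 4, 25) v, dot (-26, 8, 2) v)"

definition proj_line :: "int_triple \<Rightarrow> int_triple" where
  "proj_line l = (dot (-192, -652, 112) l, dot (-38, -260, 546) l, dot (-293, 642, -91) l)"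

text \<open>The transpose of a matrix times its cofactor matrix is the determinant times the
  identity. As 12572 is nonzero, incidence survives the coordinate change.\<close>

lemma proj_incidence:
  assumes "proj_point v = (x, y, w)" "proj_line l = (a, b, c)"
  shows "a * x + b * y + c * w = 12572 * dot v l"
proof -
  have "case proj_point v of (x, y, w) \<Rightarrow> case proj_line l of (a, b, c) \<Rightarrow>
      a * x + b * y + c * w = 12572 * dot v l"
    by (cases v; cases l) (simp add: proj_point_def proj_line_def algebra_simps)
  then show ?thesis
    using assms by simp
qed

text \<open>In cross-multiplied form: the abscissae x / w are distinct, the axis points - c / a are distinct,
  and no axis point lies vertically below a point.\<close>

definition in_general_position :: "int_triple list \<Rightarrow> int_triple list \<Rightarrow> bool" where
  "in_general_position P L \<longleftrightarrow> (let P = map proj_point P; L = map proj_line L in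
     list_all (\<lambda>(x, y, w). y \<noteq> 0 \<and> w \<noteq> 0) P \<and>
     list_all (\<lambda>(a, b, c). a \<noteq> 0 \<and> b \<noteq> 0) L \<and>
     sorted_wrt (\<lambda>(x, y, w) (x', y', w'). x * w' \<noteq> x' * w) P \<and>
     sorted_wrt (\<lambda>(a, b, c) (a', b', c'). a * c' \<noteq> a' * c) L \<and>
     list_all (\<lambda>(x, y, w). list_all (\<lambda>(a, b, c). a * x + c * w \<noteq> 0) L) P)"

text \<open>Since \<open>dot\<close> is symmetric, exchanging the arguments gives the numbers of
  points on the lines.\<close>

definition degrees :: "int_triple list \<Rightarrow> int_triple list \<Rightarrow> nat list" where
  "degrees P L = map (\<lambda>p. length (filter (\<lambda>l. dot p l = 0) L)) P"

section \<open>The affine chart of the projective plane\<close>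

definition chart_point :: "int_triple \<Rightarrow> real \<times> real" where
  "chart_point v = (case proj_point v of (x, y, w) \<Rightarrow> (of_int x / of_int w, of_int y / of_int w))"

text \<open>The slope and intercept result from solving a x + b y + c = 0 for y.\<close>

definition chart_line :: "int_triple \<Rightarrow> real \<times> real" where
  "chart_line l = (case proj_line l of (a, b, c) \<Rightarrow> (- of_int a / of_int b, - of_int c / of_int b))"

lemma dot_commute: "dot u v = dot v u"
  by (cases u; cases v) simp

text \<open>Applied with R a cross-multiplied disequation: \<open>sorted_wrt R\<close> then tests
  every pair of entries once, in integer arithmetic, while f takes real values.\<close>

lemma distinct_map_of_sorted_wrt:
  assumes "sorted_wrt R xs" "\<And>x y. x \<in> set xs \<Longrightarrow> y \<in> set xs \<Longrightarrow> R x y \<Longrightarrow> f x \<noteq> f y"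
  shows "distinct (map f xs)"
  using assms by (induction xs) auto

lemma chart_slope_intercept_sum:
  assumes "proj_point v = (x, y, w)" "w \<noteq> 0" "proj_line l = (a, b, c)" "b \<noteq> 0"
  shows "fst (chart_line l) * fst (chart_point v) + snd (chart_line l)
    = - of_int (a * x + c * w) / of_int (b * w)"
  using assms by (simp add: chart_point_def chart_line_def field_simps)

lemma chart_incidence:
  assumes "proj_point v = (x, y, w)" "w \<noteq> 0" "proj_line l = (a, b, c)" "b \<noteq> 0"
  shows "on_line (chart_point v) (chart_line l) \<longleftrightarrow> dot v l = 0"
proof -
  have "on_line (chart_point v) (chart_line l) \<longleftrightarrow>
      (of_int y :: real) / of_int w = - of_int (a * x + c * w) / of_int (b * w)"
    using chart_slope_intercept_sum[OF assms] assms(1) by (simp add: on_line_def chart_point_def)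
  also have "\<dots> \<longleftrightarrow> (of_int (a * x + b * y + c * w) :: real) = 0"
    using assms(2,4) by (simp add: divide_simps) (auto simp: algebra_simps)
  also have "\<dots> \<longleftrightarrow> dot v l = 0"
    by (simp add: proj_incidence[OF assms(1,3)] del: of_int_add of_int_mult)
  finally show ?thesis .
qed

lemma axis_hit_chart_line:
  assumes "proj_line l = (a, b, c)" "b \<noteq> 0"
  shows "axis_hit (chart_line l) = - of_int c / of_int a"
  using assms by (simp add: axis_hit_def chart_line_def)

text \<open>Translates the integer tests into the geometric hypotheses of
  \<open>affine_replication\<close>; the nonzero denominators turn cross-multiplied disequations
  into disequations of fractions.\<close>

lemma in_general_positionD:
  assumes "in_general_position P L"
  shows "distinct (map (fst \<circ> chart_point) P)"
    and "distinct (map (axis_hit \<circ> chart_line) L)"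
    and "\<And>v. v \<in> set P \<Longrightarrow> snd (chart_point v) \<noteq> 0"
    and "\<And>l. l \<in> set L \<Longrightarrow> fst (chart_line l) \<noteq> 0"
    and "\<And>v l. v \<in> set P \<Longrightarrow> l \<in> set L \<Longrightarrow>
      fst (chart_line l) * fst (chart_point v) + snd (chart_line l) \<noteq> 0"
    and "\<And>v l. v \<in> set P \<Longrightarrow> l \<in> set L \<Longrightarrow>
      on_line (chart_point v) (chart_line l) \<longleftrightarrow> dot v l = 0"
proof -
  note gp = assms[unfolded in_general_position_def Let_def list_all_iff set_map ball_simps sorted_wrt_map]
  have point: "y \<noteq> 0" "w \<noteq> 0" if "v \<in> set P" "proj_point v = (x, y, w)" for v x y w
    using gp that by fastforce+
  have line: "a \<noteq> 0" "b \<noteq> 0" if "l \<in> set L" "proj_line l = (a, b, c)" for l a b c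
    using gp that by fastforce+
  show "distinct (map (fst \<circ> chart_point) P)"
  proof (rule distinct_map_of_sorted_wrt)
    show "sorted_wrt (\<lambda>u v. (case proj_point u of (x, y, w) \<Rightarrow> \<lambda>(x', y', w').
      x * w' \<noteq> x' * w) (proj_point v)) P"
      using gp by blast
    fix u v assume uv: "u \<in> set P" "v \<in> set P" and ne:
      "(case proj_point u of (x, y, w) \<Rightarrow> \<lambda>(x', y', w'). x * w' \<noteq> x' * w) (proj_point v)"
    obtain x y w x' y' w' where eq: "proj_point u = (x, y, w)" "proj_point v = (x', y', w')"
      by (metis prod_cases3)
    have "(of_int (x * w') :: real) \<noteq> of_int (x' * w)"
      using ne eq by (simp del: of_int_mult)
    then show "(fst \<circ> chart_point) u \<noteq> (fst \<circ> chart_point) v"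
      using point[OF uv(1) eq(1)] point[OF uv(2) eq(2)] eq by (simp add: chart_point_def field_simps)
  qed
  show "distinct (map (axis_hit \<circ> chart_line) L)"
  proof (rule distinct_map_of_sorted_wrt)
    show "sorted_wrt (\<lambda>l m. (case proj_line l of (a, b, c) \<Rightarrow> \<lambda>(a', b', c').
      a * c' \<noteq> a' * c) (proj_line m)) L"
      using gp by blast
    fix l m assume lm: "l \<in> set L" "m \<in> set L" and ne:
      "(case proj_line l of (a, b, c) \<Rightarrow> \<lambda>(a', b', c'). a * c' \<noteq> a' * c) (proj_line m)"
    obtain a b c a' b' c' where eq: "proj_line l = (a, b, c)" "proj_line m = (a', b', c')"
      by (metis prod_cases3)
    have "(of_int (a * c') :: real) \<noteq> of_int (a' * c)"
      using ne eq by (simp del: of_int_mult)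
    then show "(axis_hit \<circ> chart_line) l \<noteq> (axis_hit \<circ> chart_line) m"
      using line[OF lm(1) eq(1)] line[OF lm(2) eq(2)] eq by (simp add: axis_hit_chart_line field_simps)
  qed
  show "snd (chart_point v) \<noteq> 0" if "v \<in> set P" for v
    using point[OF that] by (auto simp: chart_point_def split: prod.splits)
  show "fst (chart_line l) \<noteq> 0" if "l \<in> set L" for l
    using line[OF that] by (auto simp: chart_line_def split: prod.splits)
  fix v l assume vl: "v \<in> set P" "l \<in> set L"
  obtain x y w a b c where eq: "proj_point v = (x, y, w)" "proj_line l = (a, b, c)"
    by (metis prod_cases3)
  have nz: "w \<noteq> 0" "b \<noteq> 0"
    using point[OF vl(1) eq(1)] line[OF vl(2) eq(2)] by auto
  have "a * x + c * w \<noteq> 0"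
    using gp vl eq by fastforce
  then show "fst (chart_line l) * fst (chart_point v) + snd (chart_line l) \<noteq> 0"
    using nz unfolding chart_slope_intercept_sum[OF eq(1) nz(1) eq(2) nz(2)]
    by (simp del: of_int_add of_int_mult)
  show "on_line (chart_point v) (chart_line l) \<longleftrightarrow> dot v l = 0"
    by (rule chart_incidence[OF eq(1) nz(1) eq(2) nz(2)])
qed

text \<open>The charts are injective on the lists, since already the abscissae of the points and the
  x-intercepts of the lines are distinct. Cardinalities of incidence sets thus become lengths of
  filtered lists, which can be computed.\<close>

lemma degrees_chart:
  assumes gp: "in_general_position P L"
  defines "P' \<equiv> chart_point ` set P" and "M' \<equiv> chart_line ` set L"
  shows "card P' = length P" "card M' = length L"
    and "\<And>p. p \<in> P' \<Longrightarrow> card {l \<in> M'. on_line p l} \<in> set (degrees P L)"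
    and "\<And>l. l \<in> M' \<Longrightarrow> card {p \<in> P'. on_line p l} \<in> set (degrees L P)"
    and "card {p \<in> P'. card {l \<in> M'. on_line p l} = d} = count_list (degrees P L) d"
    and "card {l \<in> M'. card {p \<in> P'. on_line p l} = d} = count_list (degrees L P) d"
proof -
  note gpD = in_general_positionD[OF gp]
  have dist: "distinct P" "distinct L"
    using gpD(1,2) by (auto simp: distinct_map)
  have inj_point: "inj_on chart_point A" if "A \<subseteq> set P" for A
    using gpD(1) that by (auto simp: distinct_map intro: inj_on_imageI2 inj_on_subset)
  have inj_line: "inj_on chart_line A" if "A \<subseteq> set L" for A
    using gpD(2) that by (auto simp: distinct_map intro: inj_on_imageI2 inj_on_subset)
  note inj = inj_point inj_line
  show "card P' = length P" "card M' = length L"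
    using inj dist by (simp_all add: P'_def M'_def card_image distinct_card)
  have degP: "card {l \<in> M'. on_line (chart_point v) l} = length (filter (\<lambda>l. dot v l = 0) L)"
    if "v \<in> set P" for v
  proof -
    have "{l \<in> M'. on_line (chart_point v) l} = chart_line ` set (filter (\<lambda>l. dot v l = 0) L)"
      using gpD(6)[OF that] by (auto simp: M'_def)
    then show ?thesis
      using dist by (simp only: card_image inj filter_is_subset subset_refl distinct_card distinct_filter)
  qed
  have degL: "card {p \<in> P'. on_line p (chart_line l)} = length (filter (\<lambda>v. dot l v = 0) P)"
    if "l \<in> set L" for l
  proof -
    have "{p \<in> P'. on_line p (chart_line l)} = chart_point ` set (filter (\<lambda>v. dot l v = 0) P)"
      using gpD(6)[OF _ that] by (auto simp: P'_def dot_commute[of l])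
    then show ?thesis
      using dist by (simp only: card_image inj filter_is_subset subset_refl distinct_card distinct_filter)
  qed
  show "card {l \<in> M'. on_line p l} \<in> set (degrees P L)" if "p \<in> P'" for p
    using that degP by (auto simp: P'_def degrees_def)
  show "card {p \<in> P'. on_line p l} \<in> set (degrees L P)" if "l \<in> M'" for l
    using that degL by (auto simp: M'_def degrees_def)
  have count: "count_list (map f xs) d = length (filter (\<lambda>x. f x = d) xs)" for f :: "int_triple \<Rightarrow> nat" and xs
    by (induction xs) auto
  have "{p \<in> P'. card {l \<in> M'. on_line p l} = d}
      = chart_point ` set (filter (\<lambda>v. length (filter (\<lambda>l. dot v l = 0) L) = d) P)"
    using degP by (auto simp: P'_def)
  then show "card {p \<in> P'. card {l \<in> M'. on_line p l} = d} = count_list (degrees P L) d"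
    using dist unfolding degrees_def count
    by (simp only: card_image inj filter_is_subset subset_refl distinct_card distinct_filter)
  have "{l \<in> M'. card {p \<in> P'. on_line p l} = d}
      = chart_line ` set (filter (\<lambda>l. length (filter (\<lambda>v. dot l v = 0) P) = d) L)"
    using degL by (auto simp: M'_def)
  then show "card {l \<in> M'. card {p \<in> P'. on_line p l} = d} = count_list (degrees L P) d"
    using dist unfolding degrees_def count
    by (simp only: card_image inj filter_is_subset subset_refl distinct_card distinct_filter)
qed

section \<open>Computable criteria for configurations\<close>

definition replication_size :: "nat \<Rightarrow> int_triple list \<Rightarrow> int_triple list \<Rightarrow> nat \<Rightarrow> bool" where
  "replication_size k P L n \<longleftrightarrow> (let dP = degrees P L; dL = degrees L P in
     list_all (\<lambda>d. Suc d = k \<or> d = k) dP \<and> list_all (\<lambda>d. Suc d = k \<or> d = k) dL \<and>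
     k * length P + count_list dL (k - 1) = n \<and> k * length L + count_list dP (k - 1) = n)"

text \<open>The two \<open>count_list\<close> terms of \<open>replication_size\<close> are the
  cardinalities of the sets B and A of \<open>affine_replication\<close>.\<close>

lemma exists_configuration_by_replication:
  assumes gp: "in_general_position P L" and size: "replication_size k P L n" and "k > 0"
  shows "exists_geometric_configuration n k"
proof -
  note gpD = in_general_positionD[OF gp] and deg = degrees_chart[OF gp]
  note sz = size[unfolded replication_size_def Let_def list_all_iff]
  have Suc: "Suc d = k \<longleftrightarrow> d = k - 1" for d
    using \<open>k > 0\<close> by auto
  show ?thesis
  proof (rule affine_replication)
    show "card {l \<in> chart_line ` set L. on_line p l} \<in> {k - 1, k}" if "p \<in> chart_point ` set P" for p
      using deg(3)[OF that] sz Suc by blast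
    show "card {p \<in> chart_point ` set P. on_line p l} \<in> {k - 1, k}" if "l \<in> chart_line ` set L" for l
      using deg(4)[OF that] sz Suc by blast
    show "inj_on fst (chart_point ` set P)"
      using gpD(1) by (simp add: distinct_map inj_on_def) blast
    show "inj_on axis_hit (chart_line ` set L)"
      using gpD(2) by (simp add: distinct_map inj_on_def) blast
  qed (use gpD(3-5) deg(1,2,5,6) sz Suc \<open>k > 0\<close> in auto)
qed

text \<open>When every degree is already k, the chart image itself is a configuration, without
  replication and without vertical lines.\<close>

lemma exists_configuration_from_triples:
  assumes gp: "in_general_position P L"
    and deg: "list_all (\<lambda>d. d = k) (degrees P L)" "list_all (\<lambda>d. d = k) (degrees L P)"
    and len: "length P = n" "length L = n"
  shows "exists_geometric_configuration n k"
proof (rule exists_configuration_from_coordinates[where V = "{}"])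
  let ?P = "chart_point ` set P" and ?M = "chart_line ` set L"
  note dc = degrees_chart[OF gp]
  show "card {p \<in> ?P. on_line p l} = k" if "l \<in> ?M" for l
    using dc(4)[OF that] deg by (simp add: list_all_iff)
  show "card {l \<in> ?M. on_line p l} + (if fst p \<in> {} then 1 else 0) = k" if "p \<in> ?P" for p
    using dc(3)[OF that] deg by (simp add: list_all_iff)
qed (use degrees_chart(1,2)[OF gp] len in auto)

section \<open>Seeds\<close>

text \<open>As v and -v are the same projective point, the first nonzero coordinate keeps its sign
  and only later nonzero ones vary; each projective point of the orbit thus occurs once.\<close>

fun sign_orbit :: "int_triple \<Rightarrow> int_triple list" where
  "sign_orbit (a, b, c) =
     (let signs = (\<lambda>x. if x = 0 then [x] else [x, - x]) in
      if a \<noteq> 0 then concat (map (\<lambda>y. map (\<lambda>z. (a, y, z)) (signs c)) (signs b))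
      else if b \<noteq> 0 then map (\<lambda>z. (a, b, z)) (signs c)
      else [(a, b, c)])"

definition sign_orbits :: "int_triple list \<Rightarrow> int_triple list" where
  "sign_orbits vs = concat (map sign_orbit vs)"

text \<open>The seeds were found by a SAT search restricted to sets of points and lines of the projective
  plane that are invariant under changes of the signs of the homogeneous coordinates; only one
  representative of each orbit is listed.\<close>

definition replication_seeds :: "(nat \<times> int_triple list \<times> int_triple list) list" where
  "replication_seeds =
   [(126, [(1, 0, 0), (1, 1, 1), (0, 1, 2), (0, 2, 1), (1, 1, 2), (1, 2, 1), (1, 0, 3), (1, 3, 0)],
      [(1, 0, 0), (1, 0, 1), (1, 1, 0), (0, 1, 2), (0, 2, 1), (3, 1, 1), (3, 1, 2), (3, 2, 1)]),
    (129, [(0, 0, 1), (0, 1, 0), (1, 1, 1), (1, 2, 0), (1, 2, 1), (2, 1, 0), (2, 1, 1), (0, 3, 1), (3, 0, 1)],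
      [(0, 0, 1), (0, 1, 1), (1, 0, 0), (1, 0, 1), (1, 2, 0), (2, 1, 0), (1, 1, 3), (1, 2, 3), (2, 1, 3)]),
    (144, [(1, 1, 1), (1, 1, 2), (1, 2, 1), (0, 3, 2), (1, 0, 3), (1, 5, 2), (4, 5, 2)],
      [(1, 0, 1), (1, 1, 0), (2, 0, 1), (1, 2, 3), (3, 1, 1), (3, 2, 1), (4, 2, 3), (0, 2, 5)]),
    (145, [(0, 1, 0), (1, 1, 1), (1, 1, 2), (1, 2, 1), (0, 3, 2), (1, 0, 3), (1, 5, 2), (4, 5, 2)],
      [(1, 0, 1), (1, 1, 0), (2, 0, 1), (1, 2, 3), (3, 1, 1), (3, 2, 1), (4, 2, 3), (0, 2, 5)]),
    (148, [(0, 0, 1), (1, 0, 0), (1, 0, 1), (1, 1, 0), (1, 1, 1), (0, 2, 1), (1, 2, 0), (1, 2, 2), (2, 0, 1),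
      (0, 2, 3), (4, 2, 1)],
      [(0, 0, 1), (0, 1, 1), (1, 1, 0), (0, 1, 2), (1, 1, 2), (2, 1, 0), (2, 1, 2), (1, 3, 2), (2, 3, 2)]),
    (151, [(0, 1, 1), (1, 0, 1), (1, 1, 0), (1, 1, 1), (1, 2, 0), (1, 2, 1), (1, 2, 2), (3, 0, 2), (1, 4, 2)],
      [(0, 1, 0), (0, 1, 1), (1, 0, 1), (1, 1, 1), (0, 1, 2), (2, 0, 1), (2, 1, 0), (2, 1, 1), (2, 1, 3),
      (2, 2, 3)]),
    (152, [(1, 0, 1), (1, 1, 1), (1, 1, 2), (1, 2, 2), (0, 1, 3), (0, 2, 3), (3, 1, 0), (3, 2, 0), (1, 2, 4)],
      [(0, 1, 1), (1, 1, 0), (0, 2, 1), (2, 0, 1), (2, 1, 0), (1, 3, 1), (1, 3, 2), (2, 3, 1), (2, 3, 2)]),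
    (153, [(1, 1, 0), (1, 1, 1), (1, 2, 1), (1, 2, 2), (0, 3, 1), (0, 3, 2), (3, 0, 1), (3, 0, 2), (1, 4, 2)],
      [(0, 1, 1), (1, 0, 0), (1, 0, 1), (0, 1, 2), (2, 0, 1), (2, 1, 0), (1, 1, 3), (1, 2, 3), (2, 1, 3),
      (2, 2, 3)]),
    (154, [(1, 1, 0), (1, 1, 1), (1, 2, 1), (1, 2, 2), (0, 3, 1), (0, 3, 2), (3, 0, 1), (3, 0, 2), (1, 4, 2)],
      [(0, 1, 0), (0, 1, 1), (1, 0, 0), (1, 0, 1), (0, 1, 2), (2, 0, 1), (2, 1, 0), (1, 1, 3), (1, 2, 3),
      (2, 1, 3), (2, 2, 3)]),
    (155, [(0, 1, 0), (1, 0, 1), (1, 1, 1), (2, 1, 1), (2, 2, 1), (0, 1, 3), (0, 2, 3), (3, 1, 0), (3, 2, 0),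
      (4, 2, 1)],
      [(0, 0, 1), (0, 1, 1), (1, 0, 0), (1, 1, 0), (0, 1, 2), (1, 0, 2), (1, 2, 0), (1, 3, 1), (1, 3, 2),
      (2, 3, 1), (2, 3, 2)]),
    (156, [(0, 1, 0), (1, 1, 0), (1, 1, 1), (0, 2, 1), (1, 2, 0), (1, 2, 2), (2, 0, 1), (2, 2, 1), (3, 0, 2),
      (1, 4, 2)],
      [(0, 1, 0), (0, 1, 1), (1, 1, 0), (0, 1, 2), (1, 0, 2), (1, 1, 2), (2, 0, 1), (2, 1, 2), (2, 1, 3),
      (2, 2, 3)]),
    (157, [(0, 1, 1), (1, 0, 0), (1, 1, 1), (1, 1, 2), (2, 1, 2), (1, 0, 3), (1, 3, 0), (2, 0, 3), (2, 3, 0),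
      (2, 1, 4)],
      [(0, 0, 1), (0, 1, 1), (1, 0, 1), (1, 1, 0), (0, 2, 1), (1, 2, 0), (2, 0, 1), (3, 1, 1), (3, 1, 2),
      (3, 2, 1), (3, 2, 2)]),
    (158, [(1, 1, 0), (1, 1, 1), (2, 1, 0), (2, 1, 1), (2, 1, 2), (0, 3, 1), (0, 3, 2), (3, 0, 1), (3, 0, 2),
      (4, 1, 2)],
      [(0, 0, 1), (0, 1, 0), (0, 1, 1), (1, 0, 1), (0, 2, 1), (1, 0, 2), (1, 2, 0), (1, 1, 3), (1, 2, 3),
      (2, 1, 3), (2, 2, 3)]),
    (159, [(1, 0, 1), (1, 1, 1), (2, 0, 1), (2, 1, 1), (2, 2, 1), (0, 1, 3), (0, 2, 3), (3, 1, 0), (3, 2, 0),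
      (4, 2, 1)],
      [(0, 0, 1), (0, 1, 0), (0, 1, 1), (1, 0, 0), (1, 1, 0), (0, 1, 2), (1, 0, 2), (1, 2, 0), (1, 3, 1),
      (1, 3, 2), (2, 3, 1), (2, 3, 2)]),
    (160, [(1, 0, 1), (1, 1, 0), (1, 1, 1), (1, 1, 2), (1, 2, 1), (1, 2, 2), (2, 1, 0), (0, 3, 2), (4, 1, 2)],
      [(0, 1, 1), (1, 0, 1), (1, 1, 0), (1, 1, 1), (0, 2, 1), (1, 2, 1), (2, 0, 1), (2, 1, 0), (1, 2, 3),
      (2, 2, 3)]),
    (161, [(0, 0, 1), (0, 1, 0), (0, 1, 1), (1, 0, 1), (1, 1, 0), (1, 0, 2), (1, 2, 2), (2, 1, 1), (2, 1, 2),
      (3, 2, 0), (1, 2, 4)],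
      [(0, 0, 1), (0, 1, 1), (1, 0, 0), (1, 0, 1), (1, 1, 1), (0, 2, 1), (1, 2, 0), (2, 1, 0), (2, 2, 1),
      (2, 3, 1), (2, 3, 2)]),
    (162, [(0, 0, 1), (0, 1, 1), (1, 0, 0), (0, 1, 2), (1, 1, 2), (1, 2, 1), (2, 2, 1), (1, 0, 3), (1, 3, 0),
      (2, 0, 3), (2, 3, 0), (2, 4, 1)],
      [(1, 0, 0), (1, 1, 0), (0, 1, 2), (0, 2, 1), (1, 0, 2), (2, 1, 0), (3, 1, 1), (3, 1, 2), (3, 2, 1),
      (3, 2, 2)]),
    (163, [(0, 0, 1), (0, 1, 0), (0, 1, 1), (1, 0, 1), (1, 1, 0), (1, 2, 0), (1, 2, 2), (2, 1, 1), (2, 2, 1),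
      (3, 0, 2), (1, 4, 2)],
      [(0, 1, 1), (1, 0, 0), (1, 1, 0), (1, 1, 1), (0, 1, 2), (1, 0, 2), (2, 0, 1), (2, 1, 0), (2, 1, 2),
      (2, 1, 3), (2, 2, 3)]),
    (164, [(0, 1, 1), (1, 1, 0), (1, 1, 1), (1, 0, 2), (1, 1, 2), (1, 2, 0), (1, 2, 1), (0, 3, 2), (3, 0, 1),
      (1, 5, 2)],
      [(0, 0, 1), (0, 1, 0), (1, 0, 1), (1, 1, 0), (2, 0, 1), (2, 1, 1), (1, 1, 3), (1, 2, 3), (3, 1, 1),
      (4, 2, 3)]),
    (165, [(1, 1, 0), (1, 1, 1), (0, 1, 2), (2, 1, 0), (2, 1, 1), (2, 1, 2), (0, 3, 1), (3, 0, 1), (3, 0, 2),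
      (4, 1, 2)],
      [(0, 1, 1), (1, 0, 0), (1, 0, 1), (0, 2, 1), (1, 2, 0), (1, 2, 1), (1, 1, 3), (1, 2, 3), (2, 1, 3),
      (2, 2, 3)]),
    (166, [(1, 0, 1), (1, 1, 1), (1, 0, 2), (1, 1, 2), (1, 2, 0), (1, 2, 2), (0, 1, 3), (0, 2, 3), (3, 1, 0),
      (1, 2, 4)],
      [(0, 0, 1), (0, 1, 1), (1, 0, 0), (1, 1, 0), (2, 0, 1), (2, 1, 0), (2, 1, 1), (1, 3, 1), (1, 3, 2),
      (2, 3, 1), (2, 3, 2)]),
    (167, [(1, 1, 0), (1, 1, 1), (0, 1, 2), (2, 1, 0), (2, 1, 1), (2, 1, 2), (0, 3, 1), (3, 0, 1), (3, 0, 2),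
      (4, 1, 2)],
      [(0, 1, 1), (1, 0, 0), (1, 0, 1), (0, 2, 1), (1, 0, 2), (1, 2, 0), (1, 2, 1), (1, 1, 3), (1, 2, 3),
      (2, 1, 3), (2, 2, 3)]),
    (168, [(0, 1, 1), (1, 1, 1), (0, 1, 2), (1, 1, 2), (2, 1, 0), (2, 1, 2), (1, 0, 3), (1, 3, 0), (2, 0, 3),
      (2, 1, 4)],
      [(0, 0, 1), (0, 1, 0), (1, 0, 1), (1, 1, 0), (0, 2, 1), (1, 2, 0), (1, 2, 1), (2, 0, 1), (3, 1, 1),
      (3, 1, 2), (3, 2, 1), (3, 2, 2)]),
    (169, [(0, 0, 1), (0, 1, 1), (1, 1, 1), (0, 1, 2), (1, 1, 2), (1, 2, 1), (2, 1, 0), (2, 1, 1), (1, 0, 3),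
      (4, 1, 2)],
      [(0, 1, 1), (1, 1, 0), (1, 1, 1), (0, 2, 1), (1, 0, 2), (1, 2, 0), (1, 2, 1), (1, 2, 3), (3, 1, 1),
      (3, 2, 1)]),
    (170, [(0, 1, 1), (1, 0, 1), (1, 1, 0), (0, 2, 1), (1, 1, 2), (2, 0, 1), (2, 2, 1), (0, 2, 3), (2, 0, 3),
      (2, 4, 1), (4, 2, 1)],
      [(1, 1, 0), (1, 1, 1), (0, 1, 2), (1, 0, 2), (1, 1, 2), (1, 3, 2), (2, 3, 2), (3, 1, 2), (3, 2, 2)]),
    (171, [(1, 0, 0), (1, 0, 1), (1, 1, 0), (1, 1, 1), (0, 1, 2), (1, 1, 2), (1, 2, 1), (2, 0, 1), (2, 1, 4),
      (4, 2, 1)],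
      [(1, 0, 1), (1, 1, 1), (0, 1, 2), (0, 2, 1), (1, 1, 2), (1, 2, 0), (1, 2, 1), (2, 0, 1), (1, 3, 2),
      (3, 2, 1)]),
    (172, [(0, 1, 1), (1, 1, 1), (0, 1, 2), (1, 0, 2), (1, 1, 2), (1, 2, 0), (2, 1, 2), (1, 0, 3), (1, 5, 2),
      (4, 5, 2)],
      [(1, 0, 1), (1, 1, 0), (0, 2, 1), (2, 0, 1), (2, 1, 1), (2, 2, 1), (3, 1, 1), (3, 2, 1), (4, 2, 3),
      (0, 2, 5)]),
    (173, [(0, 1, 1), (1, 2, 1), (2, 1, 0), (2, 1, 2), (0, 3, 2), (1, 0, 3), (2, 3, 0), (2, 1, 4), (1, 5, 2),
      (4, 5, 2)],
      [(0, 0, 1), (1, 0, 1), (1, 2, 0), (2, 0, 1), (1, 2, 3), (3, 1, 1), (3, 2, 1), (3, 2, 2), (4, 2, 3),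
      (0, 2, 5)]),
    (174, [(0, 1, 1), (1, 0, 1), (1, 1, 0), (1, 1, 1), (0, 1, 2), (0, 2, 1), (2, 1, 1), (2, 0, 3), (2, 3, 0),
      (2, 1, 4), (2, 4, 1)],
      [(0, 1, 1), (1, 1, 1), (1, 0, 2), (1, 1, 2), (1, 2, 0), (1, 2, 1), (3, 1, 2), (3, 2, 1), (3, 2, 2)]),
    (175, [(0, 1, 1), (1, 0, 1), (1, 1, 0), (1, 1, 1), (0, 1, 2), (0, 2, 1), (2, 1, 1), (2, 0, 3), (2, 3, 0),
      (2, 1, 4), (2, 4, 1)],
      [(0, 1, 0), (0, 1, 1), (1, 1, 1), (1, 0, 2), (1, 1, 2), (1, 2, 0), (1, 2, 1), (3, 1, 2), (3, 2, 1),
      (3, 2, 2)]),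
    (176, [(0, 1, 1), (1, 0, 1), (1, 1, 0), (1, 1, 1), (1, 0, 2), (1, 2, 1), (2, 0, 1), (0, 2, 3), (3, 2, 0),
      (1, 2, 4), (4, 2, 1)],
      [(0, 0, 1), (1, 0, 0), (1, 0, 1), (1, 1, 1), (0, 1, 2), (1, 1, 2), (2, 1, 0), (2, 1, 1), (1, 3, 2),
      (2, 3, 1), (2, 3, 2)]),
    (177, [(1, 1, 0), (1, 1, 1), (1, 0, 2), (1, 2, 2), (2, 0, 1), (2, 1, 2), (0, 2, 3), (3, 2, 0), (1, 2, 4),
      (4, 2, 1)],
      [(0, 1, 0), (0, 1, 1), (1, 0, 1), (0, 2, 1), (1, 1, 2), (1, 2, 0), (2, 1, 0), (2, 2, 1), (1, 3, 2),
      (2, 3, 1), (2, 3, 2)]),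
    (178, [(0, 1, 1), (1, 1, 1), (1, 0, 2), (2, 0, 1), (2, 1, 2), (2, 2, 1), (0, 2, 3), (3, 2, 0), (1, 2, 4),
      (4, 2, 1)],
      [(0, 1, 0), (1, 0, 0), (1, 0, 1), (1, 1, 0), (0, 1, 2), (0, 2, 1), (1, 2, 0), (1, 2, 2), (2, 1, 1),
      (1, 3, 2), (2, 3, 1), (2, 3, 2)]),
    (179, [(1, 0, 0), (1, 1, 0), (1, 1, 1), (0, 1, 2), (0, 2, 1), (1, 2, 2), (2, 1, 2), (2, 0, 3), (2, 3, 0),
      (2, 1, 4), (2, 4, 1)],
      [(0, 1, 1), (0, 2, 1), (1, 1, 2), (1, 2, 0), (2, 0, 1), (2, 1, 0), (2, 2, 1), (3, 1, 2), (3, 2, 1),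
      (3, 2, 2)]),
    (180, [(1, 1, 0), (1, 1, 1), (1, 0, 2), (1, 2, 0), (1, 2, 2), (2, 0, 1), (2, 1, 2), (0, 2, 3), (1, 2, 4),
      (4, 2, 1)],
      [(0, 0, 1), (0, 1, 0), (0, 1, 1), (1, 0, 1), (0, 2, 1), (1, 1, 2), (1, 2, 0), (2, 1, 0), (2, 1, 1),
      (2, 2, 1), (1, 3, 2), (2, 3, 2)]),
    (181, [(0, 1, 0), (0, 1, 1), (1, 0, 1), (1, 1, 1), (0, 1, 2), (2, 0, 1), (2, 1, 0), (2, 2, 1), (0, 2, 3),
      (2, 3, 0), (2, 1, 4), (4, 2, 1)],
      [(1, 0, 1), (0, 1, 2), (1, 0, 2), (1, 2, 0), (1, 2, 1), (1, 2, 2), (1, 3, 2), (2, 3, 2), (3, 2, 1),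
      (3, 2, 2)]),
    (182, [(1, 0, 1), (1, 1, 0), (1, 1, 1), (2, 0, 1), (2, 1, 0), (2, 1, 2), (2, 2, 1), (0, 2, 3), (0, 3, 2),
      (4, 1, 2), (4, 2, 1)],
      [(0, 0, 1), (0, 1, 0), (1, 0, 1), (1, 1, 0), (0, 1, 2), (0, 2, 1), (1, 0, 2), (1, 2, 0), (1, 2, 3),
      (1, 3, 2), (2, 2, 3), (2, 3, 2)]),
    (183, [(0, 1, 0), (0, 1, 1), (1, 1, 1), (1, 0, 2), (2, 0, 1), (2, 1, 0), (2, 1, 2), (2, 2, 1), (0, 2, 3),
      (3, 2, 0), (1, 2, 4), (4, 2, 1)],
      [(0, 0, 1), (1, 0, 1), (0, 1, 2), (0, 2, 1), (1, 0, 2), (1, 2, 0), (1, 2, 2), (2, 1, 1), (1, 3, 2),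
      (2, 3, 1), (2, 3, 2)]),
    (184, [(1, 0, 1), (1, 1, 0), (1, 0, 2), (1, 1, 2), (1, 2, 0), (1, 2, 1), (2, 1, 1), (0, 1, 3), (0, 3, 1),
      (1, 2, 4), (1, 4, 2)],
      [(1, 1, 1), (0, 1, 2), (0, 2, 1), (2, 0, 1), (2, 1, 0), (2, 1, 1), (1, 1, 3), (1, 3, 1), (2, 1, 3),
      (2, 3, 1)]),
    (185, [(1, 0, 1), (1, 1, 0), (1, 1, 1), (1, 0, 2), (1, 2, 0), (1, 2, 1), (2, 1, 1), (2, 2, 1), (0, 3, 1),
      (3, 2, 0), (1, 2, 4)],
      [(0, 1, 0), (1, 1, 0), (1, 1, 1), (0, 1, 2), (1, 0, 2), (2, 1, 0), (2, 1, 1), (1, 1, 3), (2, 1, 3),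
      (2, 3, 1), (2, 3, 2)]),
    (186, [(0, 1, 0), (0, 1, 1), (1, 1, 0), (0, 1, 2), (1, 1, 2), (1, 2, 1), (2, 1, 0), (2, 1, 1), (1, 0, 3),
      (3, 0, 1), (2, 1, 4), (4, 1, 2)],
      [(0, 1, 0), (1, 1, 1), (0, 2, 1), (1, 0, 2), (1, 2, 0), (1, 2, 1), (2, 0, 1), (1, 1, 3), (1, 2, 3),
      (3, 1, 1), (3, 2, 1)]),
    (187, [(1, 0, 1), (1, 1, 1), (0, 2, 1), (1, 1, 2), (2, 0, 1), (2, 1, 1), (0, 2, 3), (3, 1, 0), (3, 2, 0),
      (1, 2, 4), (2, 4, 1)],
      [(0, 1, 1), (1, 0, 0), (0, 2, 1), (1, 0, 2), (1, 1, 2), (2, 1, 0), (1, 3, 1), (1, 3, 2), (2, 3, 1),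
      (2, 3, 2), (3, 1, 2)]),
    (188, [(0, 1, 1), (1, 0, 1), (0, 1, 2), (1, 0, 2), (1, 2, 0), (1, 2, 2), (2, 1, 0), (2, 1, 2), (2, 2, 1),
      (1, 4, 2), (4, 1, 2)],
      [(0, 1, 2), (0, 2, 1), (1, 0, 2), (1, 2, 1), (1, 2, 2), (2, 0, 1), (2, 1, 1), (2, 1, 2), (2, 2, 1),
      (2, 2, 3)]),
    (189, [(0, 1, 1), (1, 1, 0), (1, 1, 1), (1, 0, 2), (1, 2, 2), (2, 0, 1), (2, 1, 2), (2, 2, 1), (1, 2, 4),
      (4, 2, 1)],
      [(0, 1, 0), (0, 1, 1), (1, 1, 0), (0, 1, 2), (0, 2, 1), (1, 1, 2), (1, 2, 0), (1, 2, 2), (2, 1, 0),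
      (2, 1, 1), (2, 2, 1), (2, 3, 2)]),
    (190, [(0, 1, 1), (1, 0, 1), (1, 1, 1), (0, 1, 2), (0, 2, 1), (1, 2, 2), (2, 0, 1), (2, 1, 0), (2, 2, 1),
      (2, 3, 0), (2, 1, 4), (2, 4, 1)],
      [(0, 1, 1), (1, 0, 2), (1, 1, 2), (1, 2, 1), (1, 2, 2), (2, 0, 1), (2, 1, 0), (2, 1, 2), (3, 2, 1),
      (3, 2, 2)]),
    (191, [(1, 0, 1), (1, 1, 0), (1, 1, 1), (0, 1, 2), (1, 0, 2), (1, 2, 0), (1, 2, 2), (2, 1, 0), (2, 2, 1),
      (0, 3, 2), (1, 4, 2), (4, 1, 2)],
      [(1, 0, 0), (1, 1, 0), (0, 1, 2), (1, 0, 2), (1, 2, 1), (2, 0, 1), (2, 1, 1), (2, 1, 2), (2, 2, 1),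
      (1, 2, 3), (2, 2, 3)]),
    (193, [(0, 0, 1), (1, 0, 1), (1, 1, 1), (0, 2, 1), (1, 1, 2), (2, 1, 1), (0, 1, 3), (0, 2, 3), (1, 2, 4),
      (2, 4, 1), (4, 2, 1)],
      [(0, 2, 1), (1, 0, 2), (1, 1, 2), (1, 2, 0), (2, 1, 0), (1, 3, 1), (1, 3, 2), (2, 3, 1), (2, 3, 2),
      (3, 1, 2)]),
    (194, [(0, 0, 1), (1, 0, 0), (1, 0, 1), (1, 1, 0), (1, 1, 1), (0, 1, 2), (1, 2, 1), (2, 1, 1), (3, 0, 2),
      (1, 4, 2), (2, 1, 4), (4, 1, 2)],
      [(1, 0, 1), (1, 1, 0), (1, 1, 1), (0, 1, 2), (0, 2, 1), (1, 0, 2), (1, 2, 0), (1, 2, 1), (2, 0, 1),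
      (2, 1, 3), (2, 2, 3), (3, 2, 1)]),
    (196, [(1, 0, 1), (1, 1, 0), (1, 1, 1), (1, 0, 2), (1, 1, 2), (1, 2, 2), (2, 0, 1), (2, 1, 2), (0, 1, 3),
      (3, 1, 0), (3, 2, 0), (4, 2, 1)],
      [(0, 1, 1), (1, 0, 1), (0, 2, 1), (1, 1, 2), (1, 2, 0), (2, 0, 1), (2, 2, 1), (1, 3, 1), (1, 3, 2),
      (2, 3, 1), (2, 3, 2)]),
    (197, [(0, 1, 0), (0, 1, 1), (1, 1, 0), (1, 1, 1), (1, 1, 2), (1, 2, 1), (2, 0, 1), (2, 0, 3), (2, 3, 0),
      (2, 1, 4), (2, 4, 1), (4, 2, 1)],
      [(1, 0, 1), (1, 1, 1), (0, 1, 2), (1, 1, 2), (1, 2, 0), (2, 0, 1), (2, 1, 0), (1, 3, 2), (3, 1, 2),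
      (3, 2, 1), (3, 2, 2)]),
    (199, [(0, 0, 1), (0, 1, 1), (1, 1, 1), (0, 1, 2), (1, 2, 0), (2, 1, 2), (2, 2, 1), (2, 3, 0), (3, 0, 2),
      (1, 4, 2), (2, 1, 4), (4, 1, 2)],
      [(1, 1, 0), (0, 1, 2), (0, 2, 1), (1, 0, 2), (1, 2, 0), (1, 2, 1), (2, 1, 1), (2, 1, 3), (2, 2, 3),
      (3, 2, 1), (3, 2, 2)]),
    (200, [(0, 1, 1), (1, 0, 0), (1, 0, 1), (1, 1, 0), (1, 1, 1), (1, 1, 2), (2, 1, 2), (2, 2, 1), (0, 2, 3),
      (2, 0, 3), (2, 4, 1), (4, 2, 1)],
      [(1, 0, 0), (1, 0, 1), (1, 1, 1), (0, 1, 2), (0, 2, 1), (1, 0, 2), (1, 1, 2), (1, 2, 0), (1, 3, 2),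
      (2, 3, 2), (3, 1, 2), (3, 2, 2)]),
    (201, [(1, 0, 1), (1, 1, 0), (1, 1, 1), (0, 1, 2), (0, 2, 1), (1, 0, 2), (1, 2, 2), (2, 1, 2), (2, 2, 1),
      (2, 3, 0), (2, 1, 4), (2, 4, 1)],
      [(0, 1, 0), (0, 1, 1), (1, 0, 1), (1, 1, 0), (1, 0, 2), (1, 1, 2), (1, 2, 0), (2, 0, 1), (2, 1, 0),
      (2, 1, 2), (2, 2, 1), (3, 2, 1), (3, 2, 2)]),
    (202, [(0, 1, 1), (1, 1, 0), (1, 1, 1), (1, 0, 2), (1, 2, 0), (1, 2, 2), (2, 0, 1), (2, 1, 2), (2, 2, 1),
      (0, 2, 3), (1, 2, 4), (4, 2, 1)],
      [(0, 0, 1), (0, 1, 0), (0, 1, 1), (1, 0, 1), (1, 1, 0), (0, 1, 2), (0, 2, 1), (1, 2, 0), (1, 2, 2),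
      (2, 1, 0), (2, 1, 1), (2, 2, 1), (1, 3, 2), (2, 3, 2)]),
    (203, [(0, 0, 1), (1, 0, 0), (1, 0, 1), (1, 1, 0), (1, 1, 1), (0, 1, 2), (0, 2, 1), (1, 2, 2), (2, 1, 2),
      (2, 2, 1), (2, 3, 0), (2, 1, 4), (2, 4, 1)],
      [(0, 1, 0), (0, 1, 1), (1, 0, 1), (0, 1, 2), (1, 0, 2), (1, 1, 2), (1, 2, 0), (2, 0, 1), (2, 1, 0),
      (2, 1, 2), (2, 2, 1), (3, 2, 1), (3, 2, 2)]),
    (204, [(1, 1, 1), (0, 1, 2), (0, 2, 1), (1, 0, 2), (1, 2, 0), (1, 2, 2), (2, 1, 0), (2, 1, 2), (2, 2, 1),
      (2, 0, 3), (2, 1, 4), (2, 4, 1)],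
      [(0, 0, 1), (0, 1, 0), (1, 0, 1), (1, 1, 0), (1, 0, 2), (1, 2, 0), (1, 2, 1), (2, 0, 1), (2, 1, 0),
      (2, 1, 2), (2, 2, 1), (3, 1, 2), (3, 2, 2)]),
    (205, [(1, 1, 1), (0, 1, 2), (0, 2, 1), (1, 0, 2), (1, 2, 2), (2, 0, 1), (2, 1, 0), (2, 1, 2), (2, 2, 1),
      (3, 2, 0), (1, 2, 4), (4, 2, 1)],
      [(0, 0, 1), (0, 1, 0), (0, 1, 1), (1, 0, 0), (1, 1, 0), (0, 1, 2), (0, 2, 1), (1, 1, 2), (1, 2, 0),
      (1, 2, 2), (2, 1, 0), (2, 2, 1), (2, 3, 1), (2, 3, 2)]),
    (206, [(1, 0, 1), (1, 1, 0), (1, 1, 1), (1, 0, 2), (1, 2, 0), (1, 2, 2), (2, 1, 1), (2, 1, 2), (2, 2, 1),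
      (1, 2, 4), (1, 4, 2)],
      [(0, 0, 1), (0, 1, 0), (1, 0, 1), (1, 1, 0), (0, 1, 2), (0, 2, 1), (1, 0, 2), (1, 2, 0), (2, 0, 1),
      (2, 1, 0), (2, 1, 3), (2, 2, 3), (2, 3, 1), (2, 3, 2)]),
    (207, [(0, 1, 2), (0, 2, 1), (1, 1, 2), (1, 2, 1), (2, 0, 1), (2, 1, 0), (2, 1, 2), (2, 2, 1), (1, 0, 3),
      (1, 3, 0), (2, 1, 4), (2, 4, 1)],
      [(0, 0, 1), (0, 1, 0), (1, 0, 0), (0, 1, 2), (0, 2, 1), (1, 0, 2), (1, 2, 0), (1, 2, 2), (2, 0, 1),
      (2, 1, 0), (3, 1, 1), (3, 1, 2), (3, 2, 1), (3, 2, 2)]),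
    (208, [(0, 1, 1), (1, 1, 0), (0, 2, 1), (1, 1, 2), (1, 2, 0), (1, 2, 1), (2, 1, 1), (2, 1, 2), (2, 0, 3),
      (3, 0, 2), (1, 4, 2), (2, 4, 1)],
      [(0, 0, 1), (1, 0, 0), (1, 0, 1), (1, 1, 1), (0, 1, 2), (0, 2, 1), (1, 0, 2), (1, 2, 0), (2, 0, 1),
      (2, 1, 0), (2, 1, 3), (2, 2, 3), (3, 1, 2), (3, 2, 2)]),
    (209, [(0, 0, 1), (0, 1, 0), (0, 1, 1), (1, 0, 0), (1, 0, 1), (1, 1, 0), (0, 1, 2), (1, 2, 1), (1, 2, 2),
      (2, 1, 0), (2, 2, 1), (0, 3, 2), (2, 3, 0), (2, 1, 4), (4, 1, 2)],
      [(0, 1, 1), (1, 1, 0), (1, 1, 1), (0, 1, 2), (1, 0, 2), (1, 2, 1), (2, 0, 1), (2, 1, 0), (1, 2, 3),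
      (2, 2, 3), (3, 2, 1), (3, 2, 2)]),
    (212, [(0, 1, 1), (1, 0, 1), (1, 1, 0), (1, 1, 1), (1, 1, 2), (1, 2, 1), (1, 2, 2), (2, 0, 1), (2, 1, 0),
      (2, 2, 1), (0, 2, 3), (0, 3, 2), (4, 1, 2)],
      [(0, 1, 1), (1, 0, 1), (1, 1, 1), (0, 1, 2), (0, 2, 1), (1, 0, 2), (1, 2, 2), (2, 0, 1), (1, 2, 3),
      (1, 3, 2), (2, 2, 3), (2, 3, 2)]),
    (213, [(0, 1, 1), (1, 0, 1), (1, 1, 0), (1, 1, 1), (1, 0, 2), (1, 2, 0), (1, 2, 2), (2, 1, 0), (2, 1, 2),
      (2, 2, 1), (0, 3, 2), (2, 1, 4), (4, 1, 2)],
      [(1, 0, 0), (1, 1, 0), (1, 0, 2), (1, 2, 0), (1, 2, 1), (2, 0, 1), (2, 1, 1), (2, 1, 2), (2, 2, 1),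
      (1, 2, 3), (2, 2, 3), (3, 2, 2)]),
    (215, [(1, 0, 1), (1, 1, 0), (1, 1, 1), (1, 1, 2), (1, 2, 1), (2, 1, 0), (2, 1, 1), (0, 1, 3), (0, 2, 3),
      (3, 0, 1), (1, 2, 4), (4, 2, 1)],
      [(0, 0, 1), (0, 1, 0), (0, 1, 1), (1, 0, 0), (1, 1, 0), (0, 1, 2), (0, 2, 1), (1, 2, 0), (2, 1, 0),
      (1, 1, 3), (1, 2, 3), (1, 3, 1), (1, 3, 2), (2, 3, 1), (2, 3, 2)]),
    (216, [(0, 1, 0), (0, 1, 1), (1, 0, 1), (1, 1, 1), (1, 1, 2), (1, 2, 0), (1, 2, 1), (2, 1, 0), (0, 2, 3),
      (1, 0, 3), (1, 2, 4), (2, 1, 4), (4, 2, 1)],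
      [(0, 0, 1), (0, 1, 0), (1, 0, 0), (1, 1, 0), (0, 1, 2), (0, 2, 1), (1, 2, 0), (1, 2, 1), (2, 0, 1),
      (2, 1, 0), (2, 1, 1), (1, 3, 2), (2, 3, 2), (3, 1, 1), (3, 2, 1)])]"

text \<open>The number heading a seed is the size of the configuration obtained by replication with
  k = 5, not the size of the seed. The whole check is finite integer arithmetic.\<close>

lemma replication_seeds_valid:
  "list_all (\<lambda>(n, ps, ls). let P = sign_orbits ps; L = sign_orbits ls in
     in_general_position P L \<and> replication_size 5 P L n) replication_seeds"
  by code_simp

lemma exists_configuration_of_replication_seeds:
  assumes "n \<in> set (map fst replication_seeds)"
  shows "exists_geometric_configuration n 5"
proof -
  obtain ps ls where "(n, ps, ls) \<in> set replication_seeds"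
    using assms by auto
  then have "in_general_position (sign_orbits ps) (sign_orbits ls)"
      "replication_size 5 (sign_orbits ps) (sign_orbits ls) n"
    using replication_seeds_valid by (auto simp: list_all_iff Let_def)
  then show ?thesis
    by (rule exists_configuration_by_replication) simp
qed

section \<open>A (66_5) configuration\<close>

definition points_66 :: "int_triple list" where
  "points_66 = sign_orbits
    [(0, 1, 1), (1, 0, 1), (1, 1, 0), (0, 2, 3), (0, 3, 2), (2, 0, 3), (2, 2, 3), (2, 3, 0), (2, 3, 2),
     (3, 0, 2), (3, 2, 0), (3, 2, 2), (2, 3, 6), (2, 6, 3), (3, 2, 6), (3, 6, 2), (5, 6, 6), (6, 2, 3),
     (6, 3, 2), (6, 5, 6), (6, 6, 5)]"

definition lines_66 :: "int_triple list" where
  "lines_66 = sign_orbits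
    [(0, 1, 1), (1, 0, 1), (1, 1, 0), (0, 2, 3), (0, 3, 2), (2, 0, 3), (2, 2, 3), (2, 3, 0), (2, 3, 2),
     (3, 0, 2), (3, 2, 0), (3, 2, 2), (1, 6, 6), (2, 3, 6), (2, 6, 3), (3, 2, 6), (3, 6, 2), (6, 1, 6),
     (6, 2, 3), (6, 3, 2), (6, 6, 1)]"

text \<open>Both sets are invariant under all signed permutations of the coordinates. The points
  form the orbits of (0, 1, 1), (0, 2, 3), (2, 2, 3), (2, 3, 6) and (5, 6, 6), of sizes 6, 12, 12,
  24 and 12; the lines have (1, 6, 6) in place of (5, 6, 6).\<close>

lemma exists_configuration_66: "exists_geometric_configuration 66 5"
proof (rule exists_configuration_from_triples)
  show "in_general_position points_66 lines_66"
    by code_simp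
  show "list_all (\<lambda>d. d = 5) (degrees points_66 lines_66)"
    by code_simp
  show "list_all (\<lambda>d. d = 5) (degrees lines_66 points_66)"
    by code_simp
  show "length points_66 = 66" "length lines_66 = 66"
    by code_simp+
qed

section \<open>Covering all residues modulo 66\<close>

lemma residues_mod_66_covered:
  "list_all (\<lambda>r. list_ex (\<lambda>m. m mod 66 = r \<and> m \<le> 231) (66 # map fst replication_seeds)) [0..<66]"
  by code_simp

lemma exists_configuration_ge_166:
  assumes "n \<ge> 166"
  shows "exists_geometric_configuration n 5"
proof -
  have "n mod 66 \<in> set [0..<66]"
    by simp
  then obtain m where m: "m \<in> set (66 # map fst replication_seeds)" "m mod 66 = n mod 66" "m \<le> 231"
    using residues_mod_66_covered unfolding list_all_iff list_ex_iff by blast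
  have base: "exists_geometric_configuration m 5"
    using m(1) exists_configuration_66 exists_configuration_of_replication_seeds by auto
  have multiples: "exists_geometric_configuration (m + j * 66) 5" for j
  proof (induction j)
    case 0
    show ?case
      using base by simp
  next
    case (Suc j)
    from exists_geometric_configuration_add[OF Suc exists_configuration_66] show ?case
      by (simp add: algebra_simps)
  qed
  have "m \<le> n"
  proof (rule ccontr)
    assume "\<not> m \<le> n"
    \<comment> \<open>The bound 231 is 166 + 65: if n < m, then 0 < m - n \<le> 65, so 66 cannot
      divide m - n.\<close>
    then have "66 dvd m - n"
      using m(2) by (simp add: mod_eq_dvd_iff_nat)
    then show False
      using \<open>\<not> m \<le> n\<close> m(3) assms by (auto dest: dvd_imp_le)
  qed
  then have "66 dvd n - m"
    using m(2) by (metis mod_eq_dvd_iff_nat)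
  then obtain j where "n - m = 66 * j" ..
  then have "n = m + j * 66"
    using \<open>m \<le> n\<close> by simp
  then show ?thesis
    using multiples by simp
qed

theorem mainTheorem1:
  shows "(\<forall>n\<ge>166. exists_geometric_configuration n 5) \<and> config_threshold 5 \<le> 166"
proof
  show "\<forall>n\<ge>166. exists_geometric_configuration n 5"
    using exists_configuration_ge_166 by blast
  \<comment> \<open>As 166 is itself a threshold, the minimum is attained and is at most
    166.\<close>
  then show "config_threshold 5 \<le> 166"
    unfolding config_threshold_def by (rule Least_le)
qed

end
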